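(* For all integers $n,m\ge 1$, the bistar graph with parameters $n,m$ is a difference graph.
   Context: A graph $G=(V,E)$ is a difference graph if there is a bijection $f$ from $V$ onto a set $S$ of positive integers such that for all distinct $x,y\in V$: $xy\in E$ if and only if $|f(x)-f(y)|\in S$. The bistar graph with parameters $n,m$ has vertices $u_0,u_1,\dots,u_n,v_0,v_1,\dots,v_m$ and edges $u_0u_i$ ($1\le i\le n$), $v_0v_j$ ($1\le j\le m$) and $u_0v_0$; i.e. the centres of the stars $K_{1,n}$ and $K_{1,m}$ joined by an edge. *)

theory Defs
  imports "Graph_Theory.Pair_Digraph"
begin

text \<open>
  Finite simple graphs are the \<^locale>\<open>pair_graph\<close>s of the AFP entry Graph_Theory: an
  undirected edge \<open>xy\<close> is the pair of arcs \<open>(x, y)\<close>, \<open>(y, x)\<close>. Labels are integers, so that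
  the absolute difference is not affected by truncated subtraction.
\<close>

definition difference_graph :: "'a pair_pre_digraph \<Rightarrow> bool" where
  "difference_graph G \<longleftrightarrow>
     pair_graph G \<and>
     (\<exists>(f :: 'a \<Rightarrow> int) S.
        (\<forall>s\<in>S. s > 0) \<and>
        bij_betw f (pverts G) S \<and>
        (\<forall>x\<in>pverts G. \<forall>y\<in>pverts G. x \<noteq> y \<longrightarrow>
           ((x, y) \<in> parcs G \<longleftrightarrow> \<bar>f x - f y\<bar> \<in> S)))"

datatype bistar_vertex = U nat | V nat

definition bistar_edges :: "nat \<Rightarrow> nat \<Rightarrow> (bistar_vertex \<times> bistar_vertex) set" where
  "bistar_edges n m =
     {(U 0, U i) | i. 1 \<le> i \<and> i \<le> n} \<union> {(V 0, V j) | j. 1 \<le> j \<and> j \<le> m} \<union> {(U 0, V 0)}"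

definition bistar :: "nat \<Rightarrow> nat \<Rightarrow> bistar_vertex pair_pre_digraph" where
  "bistar n m =
     \<lparr> pverts = U ` {0..n} \<union> V ` {0..m},
       parcs = bistar_edges n m \<union> (bistar_edges n m)\<inverse> \<rparr>"

lemma pair_graph_bistar: "pair_graph (bistar n m)"
proof -
  have wf: "parcs (bistar n m) \<subseteq> pverts (bistar n m) \<times> pverts (bistar n m)"
    by (auto simp: bistar_def bistar_edges_def)
  have fin: "finite (pverts (bistar n m))"
    by (simp add: bistar_def)
  have irr: "fst e \<noteq> snd e" if "e \<in> parcs (bistar n m)" for e
    using that by (auto simp: bistar_def bistar_edges_def)
  have "finite (parcs (bistar n m))"
    using wf fin by (meson finite_SigmaI finite_subset)
  moreover have "symmetric (with_proj (bistar n m))"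
    by (auto simp: symmetric_def arcs_ends_def arc_to_ends_def bistar_def sym_def
        with_proj_def image_iff)
  ultimately show ?thesis
    using wf fin irr by unfold_locales auto
qed

end

theory Submission
  imports Defs
begin

text \<open>
  Label the centres by \<open>a\<close> and \<open>2a\<close>, where \<open>a = 4b\<close> is large. The leaves of the first centre get
  pairs \<open>x, a - x\<close>, those of the second get pairs \<open>y, 2a - y\<close>, for small odd \<open>x, y\<close>; an unpaired
  leaf gets \<open>a/2\<close> at the first centre and \<open>4a\<close> at the second. Two paired leaves differ by an even
  number; by size it could only be the even label \<open>a\<close>, and \<open>(2a - y) - (a - x) = a\<close> would force
  \<open>x = y\<close>, which is excluded by taking \<open>x \<equiv> 1\<close> and \<open>y \<equiv> 3\<close> modulo 4.
\<close>

locale bistar_labels =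
  fixes b :: int and A B :: "int set"
  assumes b_pos: "b > 0"
    and A_cases: "t \<in> A \<Longrightarrow> t = 2 * b \<or> odd t \<and> (0 < t \<and> t < b \<or> 3 * b < t \<and> t < 4 * b)"
    and B_cases: "t \<in> B \<Longrightarrow> t = 16 * b \<or> odd t \<and> (0 < t \<and> t < b \<or> 7 * b < t \<and> t < 8 * b)"
    and A_sym: "t \<in> A \<Longrightarrow> 4 * b - t \<in> A"
    and B_sym: "t \<in> B \<Longrightarrow> t \<noteq> 16 * b \<Longrightarrow> 8 * b - t \<in> B"
    and disj: "A \<inter> B = {}"
begin

definition S :: "int set" where "S = {4 * b, 8 * b} \<union> A \<union> B"

lemma S_pos: "s \<in> S \<Longrightarrow> s > 0"
  using b_pos A_cases B_cases by (force simp: S_def)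

text \<open>All other labels are odd. An even difference of two leaf labels therefore has only these
  four values to avoid.\<close>

lemma even_label_cases: "s \<in> S \<Longrightarrow> even s \<Longrightarrow> s = 2 * b \<or> s = 4 * b \<or> s = 8 * b \<or> s = 16 * b"
  using A_cases B_cases by (auto simp: S_def)

lemma centres_notin: "4 * b \<notin> A" "8 * b \<notin> A" "4 * b \<notin> B" "8 * b \<notin> B"
  using b_pos A_cases[of "4 * b"] A_cases[of "8 * b"] B_cases[of "4 * b"] B_cases[of "8 * b"]
  by auto

lemma centres_adjacent: "\<bar>4 * b - 8 * b\<bar> \<in> S"
  using b_pos by (simp add: S_def)

text \<open>The difference is the label of the partner; \<open>2 * b\<close> is its own
  partner.\<close>

lemma A_adjacent_centre_A: "t \<in> A \<Longrightarrow> \<bar>4 * b - t\<bar> \<in> S"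
  using A_cases[of t] A_sym[of t] b_pos by (auto simp: S_def)

text \<open>Again the difference is the partner's label, except that \<open>16 * b\<close> has no
  partner: its difference is \<open>8 * b\<close>, the label of the centre itself.\<close>

lemma B_adjacent_centre_B: "t \<in> B \<Longrightarrow> \<bar>8 * b - t\<bar> \<in> S"
  using B_cases[of t] B_sym[of t] b_pos by (auto simp: S_def)

lemma B_nonadjacent_centre_A:
  assumes "t \<in> B" shows "\<bar>4 * b - t\<bar> \<notin> S"
proof
  assume "\<bar>4 * b - t\<bar> \<in> S"
  then consider "\<bar>4 * b - t\<bar> = 4 * b" | "\<bar>4 * b - t\<bar> = 8 * b"
    | "\<bar>4 * b - t\<bar> \<in> A" | "\<bar>4 * b - t\<bar> \<in> B"
    by (auto simp: S_def)
  then show False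
  proof cases
    case 1 then show False using B_cases[OF assms] b_pos by auto
  next
    case 2 then show False using B_cases[OF assms] b_pos by auto
  next
    case 3
    have "t \<noteq> 16 * b" using A_cases[OF 3] b_pos by auto
    then have *: "8 * b - t \<in> B" by (rule B_sym[OF assms])
    \<comment> \<open>Reflecting the element \<bar>4b - t\<bar> of \<open>A\<close> by
      \<open>A_sym\<close> gives t if t \<le> 4b, and 8b - t otherwise.\<close>
    have "t \<in> A \<or> 8 * b - t \<in> A"
      using A_sym[OF 3] by (cases "t \<le> 4 * b") (auto simp: algebra_simps)
    then show False using * assms disj by blast
  next
    case 4
    \<comment> \<open>The difference is 12b, or lies strictly between 3b and 4b; \<open>B\<close>
      has no element there.\<close>
    then show False using B_cases[OF assms] B_cases[OF 4] b_pos by auto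
  qed
qed

text \<open>Since t < 4b, the difference exceeds 4b and is too large for \<open>A\<close>. Were it
  in \<open>B\<close>, its partner t would lie in both sets.\<close>

lemma A_nonadjacent_centre_B:
  assumes "t \<in> A" shows "\<bar>8 * b - t\<bar> \<notin> S"
proof
  assume *: "\<bar>8 * b - t\<bar> \<in> S"
  have pos: "8 * b - t > 4 * b" using A_cases[OF assms] b_pos by auto
  then have "8 * b - t \<noteq> 8 * b" "8 * b - t \<notin> A"
    using A_cases[OF assms] A_cases[of "8 * b - t"] b_pos by auto
  then have B: "8 * b - t \<in> B"
    using * pos b_pos by (auto simp: S_def)
  have "8 * b - t \<noteq> 16 * b" using A_cases[OF assms] b_pos by auto
  then have "t \<in> B" using B_sym[OF B] by simp
  then show False using assms disj by blast
qed

text \<open>A difference from 2b is odd and strictly between b and 2b, where no odd label lies.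
  Otherwise it is even, and either below b or strictly between 2b and 4b.\<close>

lemma A_A_nonadjacent:
  assumes "s \<in> A" "t \<in> A" "s \<noteq> t" shows "\<bar>s - t\<bar> \<notin> S"
proof
  assume *: "\<bar>s - t\<bar> \<in> S"
  show False
  proof (cases "s = 2 * b \<or> t = 2 * b")
    case True
    then have "\<bar>s - t\<bar> > b" "\<bar>s - t\<bar> < 2 * b" "odd \<bar>s - t\<bar>"
      using A_cases[OF assms(1)] A_cases[OF assms(2)] assms(3) by auto
    then show False using * A_cases[of "\<bar>s - t\<bar>"] B_cases[of "\<bar>s - t\<bar>"] b_pos
      by (auto simp: S_def)
  next
    case False
    then have "even \<bar>s - t\<bar>"
      using A_cases[OF assms(1)] A_cases[OF assms(2)] by auto
    then show False
      using even_label_cases[OF *] False A_cases[OF assms(1)] A_cases[OF assms(2)] b_pos by auto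
  qed
qed

text \<open>A difference from 16b is odd and above 8b, beyond all odd labels. Otherwise it is even,
  and either below b or strictly between 6b and 8b.\<close>

lemma B_B_nonadjacent:
  assumes "s \<in> B" "t \<in> B" "s \<noteq> t" shows "\<bar>s - t\<bar> \<notin> S"
proof
  assume *: "\<bar>s - t\<bar> \<in> S"
  show False
  proof (cases "s = 16 * b \<or> t = 16 * b")
    case True
    then have "\<bar>s - t\<bar> > 8 * b" "\<bar>s - t\<bar> < 16 * b" "odd \<bar>s - t\<bar>"
      using B_cases[OF assms(1)] B_cases[OF assms(2)] assms(3) by auto
    then show False using * A_cases[of "\<bar>s - t\<bar>"] B_cases[of "\<bar>s - t\<bar>"] b_pos
      by (auto simp: S_def)
  next
    case False
    then have "even \<bar>s - t\<bar>"
      using B_cases[OF assms(1)] B_cases[OF assms(2)] by auto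
    then show False
      using even_label_cases[OF *] False B_cases[OF assms(1)] B_cases[OF assms(2)] b_pos by auto
  qed
qed

lemma A_B_nonadjacent:
  assumes "s \<in> A" "t \<in> B" shows "\<bar>s - t\<bar> \<notin> S"
proof
  assume *: "\<bar>s - t\<bar> \<in> S"
  consider "s = 2 * b" "t = 16 * b" | "s = 2 * b" "t \<noteq> 16 * b" | "s \<noteq> 2 * b" "t = 16 * b"
    | "s \<noteq> 2 * b" "t \<noteq> 16 * b" by blast
  then show False
  proof cases
    case 1
    then show False using even_label_cases[OF *] b_pos by auto
  next
    case 2
    then have "odd \<bar>s - t\<bar>" "b < \<bar>s - t\<bar> \<and> \<bar>s - t\<bar> < 2 * b \<or> 5 * b < \<bar>s - t\<bar> \<and> \<bar>s - t\<bar> < 6 * b"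
      using B_cases[OF assms(2)] b_pos by auto
    then show False using * A_cases[of "\<bar>s - t\<bar>"] B_cases[of "\<bar>s - t\<bar>"] b_pos
      by (auto simp: S_def)
  next
    case 3
    then have "odd \<bar>s - t\<bar>" "8 * b < \<bar>s - t\<bar>" "\<bar>s - t\<bar> < 16 * b"
      using A_cases[OF assms(1)] b_pos by auto
    then show False using * A_cases[of "\<bar>s - t\<bar>"] B_cases[of "\<bar>s - t\<bar>"] b_pos
      by (auto simp: S_def)
  next
    case 4
    then have "even \<bar>s - t\<bar>"
      using A_cases[OF assms(1)] B_cases[OF assms(2)] by auto
    \<comment> \<open>By size, 4b is the only even label that the difference could be, and only with
      t the larger. Then the partners of s and t would coincide.\<close>
    moreover have "t - s \<noteq> 4 * b"
    proof
      assume "t - s = 4 * b"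
      then have eq: "8 * b - t = 4 * b - s" by simp
      have "8 * b - t \<in> A" unfolding eq by (rule A_sym[OF assms(1)])
      then show False using B_sym[OF assms(2) 4(2)] disj by blast
    qed
    ultimately show False
      using even_label_cases[OF *] 4 A_cases[OF assms(1)] B_cases[OF assms(2)] b_pos by auto
  qed
qed

text \<open>The preceding lemmas only ask whether a leaf label lies in \<open>A\<close> or in
  \<open>B\<close>, so arbitrary enumerations of the two sets can serve as labellings.\<close>

lemma difference_graph_bistar:
  assumes "finite A" "finite B"
  shows "difference_graph (bistar (card A) (card B))"
proof -
  obtain g where g: "bij_betw g {1..card A} A"
    using assms(1) by (metis ex_bij_betw_nat_finite_1)
  obtain h where h: "bij_betw h {1..card B} B"
    using assms(2) by (metis ex_bij_betw_nat_finite_1)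
  define f where "f = case_bistar_vertex
    (\<lambda>i. if i = 0 then 4 * b else g i) (\<lambda>j. if j = 0 then 8 * b else h j)"
  let ?G = "bistar (card A) (card B)"
  let ?LU = "U ` {1..card A}" and ?LV = "V ` {1..card B}"
  have gA: "g i \<in> A" if "1 \<le> i" "i \<le> card A" for i
    using that bij_betwE[OF g] by auto
  have hB: "h j \<in> B" if "1 \<le> j" "j \<le> card B" for j
    using that bij_betwE[OF h] by auto
  have f_U0: "f (U 0) = 4 * b" and f_V0: "f (V 0) = 8 * b" by (simp_all add: f_def)
  have f_LU: "f x \<in> A" if "x \<in> ?LU" for x using that gA by (auto simp: f_def)
  have f_LV: "f x \<in> B" if "x \<in> ?LV" for x using that hB by (auto simp: f_def)
  have "{0..k} = insert 0 {1..k}" for k :: nat by auto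
  then have verts: "pverts ?G = {U 0, V 0} \<union> ?LU \<union> ?LV"
    by (simp add: bistar_def) blast
  have "bij_betw (f \<circ> U) {1..card A} A"
    using g by (subst bij_betw_cong[where g = g]) (auto simp: f_def)
  moreover have "bij_betw U {1..card A} ?LU" by (simp add: bij_betw_def inj_on_def)
  ultimately have bij_LU: "bij_betw f ?LU A" by (simp only: bij_betw_comp_iff)
  have "bij_betw (f \<circ> V) {1..card B} B"
    using h by (subst bij_betw_cong[where g = h]) (auto simp: f_def)
  moreover have "bij_betw V {1..card B} ?LV" by (simp add: bij_betw_def inj_on_def)
  ultimately have bij_LV: "bij_betw f ?LV B" by (simp only: bij_betw_comp_iff)
  have "bij_betw f {U 0, V 0} {4 * b, 8 * b}"
    using b_pos by (auto simp: bij_betw_def f_U0 f_V0)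
  then have bij: "bij_betw f (pverts ?G) S"
    unfolding verts S_def using centres_notin disj
    by (intro bij_betw_combine bij_LU bij_LV) auto
  have edge: "(x, y) \<in> parcs ?G \<longleftrightarrow>
      (x = U 0 \<and> y \<in> ?LU) \<or> (x = V 0 \<and> y \<in> ?LV) \<or> (x = U 0 \<and> y = V 0) \<or>
      (y = U 0 \<and> x \<in> ?LU) \<or> (y = V 0 \<and> x \<in> ?LV) \<or> (y = U 0 \<and> x = V 0)" for x y
    by (auto simp: bistar_def bistar_edges_def)
  have inj: "f x \<noteq> f y" if "x \<in> pverts ?G" "y \<in> pverts ?G" "x \<noteq> y" for x y
    using that bij by (auto simp: bij_betw_def inj_on_def)
  have adj: "(x, y) \<in> parcs ?G \<longleftrightarrow> \<bar>f x - f y\<bar> \<in> S"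
    if x: "x \<in> pverts ?G" and y: "y \<in> pverts ?G" and xy: "x \<noteq> y" for x y
  proof -
    note AA = A_A_nonadjacent[OF f_LU f_LU inj[OF x y xy]] and BB = B_B_nonadjacent[OF f_LV f_LV inj[OF x y xy]]
    consider "x = U 0" | "x = V 0" | "x \<in> ?LU" | "x \<in> ?LV" using x verts by blast
    then show ?thesis
    proof cases
      case 1
      then show ?thesis
        using y xy f_LU[of y] f_LV[of y] centres_adjacent A_adjacent_centre_A[of "f y"] B_nonadjacent_centre_A[of "f y"]
        by (auto simp: verts edge f_U0 f_V0)
    next
      case 2
      then show ?thesis
        using y xy f_LU[of y] f_LV[of y] centres_adjacent A_nonadjacent_centre_B[of "f y"] B_adjacent_centre_B[of "f y"]
        by (auto simp: verts edge f_U0 f_V0 abs_minus_commute)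
    next
      case 3
      then show ?thesis
        using y f_LU[of x] f_LV[of y] AA A_adjacent_centre_A[of "f x"] A_nonadjacent_centre_B[of "f x"]
          A_B_nonadjacent[of "f x" "f y"]
        unfolding verts edge by (auto simp: f_U0 f_V0 abs_minus_commute)
    next
      case 4
      then show ?thesis
        using y f_LV[of x] f_LU[of y] BB B_nonadjacent_centre_A[of "f x"] B_adjacent_centre_B[of "f x"]
          A_B_nonadjacent[of "f y" "f x"]
        unfolding verts edge by (auto simp: f_U0 f_V0 abs_minus_commute)
    qed
  qed
  show ?thesis
    unfolding difference_graph_def using pair_graph_bistar S_pos bij adj by blast
qed

end

text \<open>Elements of \<open>X\<close> lie below c/2 and their reflections above it, so the two
  sets are disjoint.\<close>

lemma card_reflected_pairs:
  fixes X :: "int set"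
  assumes "finite X" "\<And>x. x \<in> X \<Longrightarrow> 2 * x < c"
  shows "card (X \<union> (-) c ` X) = 2 * card X"
proof -
  have "card ((-) c ` X) = card X" by (intro card_image) (auto simp: inj_on_def)
  moreover have "c - x \<notin> X" if "x \<in> X" for x
    using assms(2)[of x] assms(2)[of "c - x"] that by auto
  then have "X \<inter> (-) c ` X = {}" by auto
  ultimately show ?thesis using assms(1) by (simp add: card_Un_disjoint)
qed

theorem theorem3p4:
  fixes n m :: nat
  assumes "n \<ge> 1" and "m \<ge> 1"
  shows "difference_graph (bistar n m)"
proof -
  \<comment> \<open>Elements of \<open>X\<close> are at most 2n - 3 and those of \<open>Y\<close> at
    most 2m - 1, so this \<open>b\<close> exceeds them all.\<close>
  define b :: int where "b = 2 * (int n + int m) + 4"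
  define X where "X = (\<lambda>i. 4 * int i + 1) ` {..<n div 2}"
  define Y where "Y = (\<lambda>i. 4 * int i + 3) ` {..<m div 2}"
  define A where "A = (X \<union> (-) (4 * b) ` X) \<union> (if odd n then {2 * b} else {})"
  define B where "B = (Y \<union> (-) (8 * b) ` Y) \<union> (if odd m then {16 * b} else {})"
  have b: "b > 0" by (simp add: b_def)
  have X: "odd x \<and> 0 < x \<and> x < b \<and> x mod 4 = 1" if "x \<in> X" for x
    using that by (auto simp: X_def b_def)
  have Y: "odd y \<and> 0 < y \<and> y < b \<and> y mod 4 = 3" if "y \<in> Y" for y
    using that by (auto simp: Y_def b_def)
  have fin: "finite X" "finite Y" by (simp_all add: X_def Y_def)
  have XY: "X \<inter> Y = {}" using X Y by fastforce
  have A_odd: "odd x \<and> (0 < x \<and> x < b \<or> 3 * b < x \<and> x < 4 * b)"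
    if "x \<in> X \<union> (-) (4 * b) ` X" for x using that X by fastforce
  have B_odd: "odd x \<and> (0 < x \<and> x < b \<or> 7 * b < x \<and> x < 8 * b)"
    if "x \<in> Y \<union> (-) (8 * b) ` Y" for x using that Y by fastforce
  interpret bistar_labels b A B
  proof
    show "b > 0" by (fact b)
    show "t = 2 * b \<or> odd t \<and> (0 < t \<and> t < b \<or> 3 * b < t \<and> t < 4 * b)" if "t \<in> A" for t
      using that A_odd[of t] unfolding A_def by (auto split: if_splits)
    show "t = 16 * b \<or> odd t \<and> (0 < t \<and> t < b \<or> 7 * b < t \<and> t < 8 * b)" if "t \<in> B" for t
      using that B_odd[of t] unfolding B_def by (auto split: if_splits)
    show "4 * b - t \<in> A" if "t \<in> A" for t
      using that unfolding A_def by (auto split: if_splits)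
    show "8 * b - t \<in> B" if "t \<in> B" "t \<noteq> 16 * b" for t
      using that unfolding B_def by (auto split: if_splits)
    show "A \<inter> B = {}"
    proof -
      \<comment> \<open>The bound t < 4b excludes the upper half of \<open>B\<close> and 16b,
        leaving t in \<open>Y\<close>. Then t < b excludes the upper half of \<open>A\<close> and
        2b, leaving t in \<open>X\<close>, which is impossible modulo 4.\<close>
      have False if tA: "t \<in> A" and tB: "t \<in> B" for t
      proof -
        have "t < 4 * b" using tA A_odd[of t] b unfolding A_def by (auto split: if_splits)
        then have tY: "t \<in> Y"
          using tB Y b unfolding B_def by (fastforce split: if_splits)
        then have "t < b" using Y by blast
        then have "t \<in> X"
          using tA X b unfolding A_def by (fastforce split: if_splits)
        then show False using tY XY by blast
      qed
      then show ?thesis by blast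
    qed
  qed
  have "inj_on (\<lambda>i. 4 * int i + 1) {..<n div 2}" "inj_on (\<lambda>i. 4 * int i + 3) {..<m div 2}"
    by (auto simp: inj_on_def)
  then have cards: "card X = n div 2" "card Y = m div 2"
    by (simp_all add: X_def Y_def card_image)
  have "card (X \<union> (-) (4 * b) ` X) = 2 * (n div 2)"
    using card_reflected_pairs[OF fin(1), of "4 * b"] X cards b by fastforce
  \<comment> \<open>The paired labels are odd, so the even label added for odd \<open>n\<close> is a
    new element.\<close>
  moreover have "2 * b \<notin> X \<union> (-) (4 * b) ` X" using A_odd[of "2 * b"] by auto
  ultimately have "card A = n"
    using fin by (auto simp: A_def)
  moreover have "card (Y \<union> (-) (8 * b) ` Y) = 2 * (m div 2)"
    using card_reflected_pairs[OF fin(2), of "8 * b"] Y cards b by fastforce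
  moreover have "16 * b \<notin> Y \<union> (-) (8 * b) ` Y" using B_odd[of "16 * b"] by auto
  ultimately have "card A = n" "card B = m"
    using fin by (auto simp: B_def)
  moreover have "finite A" "finite B" using fin by (simp_all add: A_def B_def)
  ultimately show ?thesis using difference_graph_bistar by metis
qed

end
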